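(* Let $G$ be a group and let $\sigma$ be a non-trivial group automorphism of $G$ (i.e. $\sigma \neq \mathrm{id}_G$). Then the quandle Euler characteristic of the generalized Alexander quandle $\mathrm{GAlex}(G,\sigma)$ is equal to $0$.
   Context: A quandle is a pair $(X,s)$ of a non-empty set $X$ and a map $s : X \to \mathrm{Map}(X,X)$, $x \mapsto s_x$ (where $\mathrm{Map}(X,X)$ is the set of all maps $X\to X$) such that: (1) $s_x(x)=x$ for all $x\in X$; (2) each $s_x$ is a bijection; (3) $s_x\circ s_y = s_{s_x(y)}\circ s_x$ for all $x,y\in X$. The displacement group $\mathrm{Dis}(X)$ is the group of bijections of $X$ generated under composition by $\{s_x\circ s_y^{-1} \mid x,y\in X\}$. For $g\in \mathrm{Dis}(X)$, $\mathrm{Fix}(g,X)=\{x\in X\mid g(x)=x\}$. The quandle Euler characteristic is $\chi^{\mathrm{Qdle}}(X)=\inf\{\#\mathrm{Fix}(g,X)\mid g\in \mathrm{Dis}(X)\}$, where $\#$ denotes cardinality. For a group $G$ and a group automorphism $\sigma$ of $G$, the generalized Alexander quandle $\mathrm{GAlex}(G,\sigma)$ is the quandle $(G,s)$ with $s_h(g)=h\,\sigma(h^{-1}g)$ for $g,h\in G$. *)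

theory Defs
  imports "HOL-Algebra.Bij" "HOL-Algebra.Generated_Groups" "HOL-Library.Extended_Nat"
begin

(* As in HOL-Algebra.Bij, a map X -> X is represented by an extensional function, so that
   equality of maps on X is equality in HOL. *)

type_synonym 'a quandle_pair = "'a set \<times> ('a \<Rightarrow> 'a \<Rightarrow> 'a)"

definition is_quandle :: "'a quandle_pair \<Rightarrow> bool" where
  "is_quandle Q \<longleftrightarrow> (case Q of (X, s) \<Rightarrow>
     X \<noteq> {} \<and>
     s \<in> X \<rightarrow> (X \<rightarrow>\<^sub>E X) \<and>
     (\<forall>x\<in>X. s x x = x) \<and>
     (\<forall>x\<in>X. bij_betw (s x) X X) \<and>
     (\<forall>x\<in>X. \<forall>y\<in>X. compose X (s x) (s y) = compose X (s (s x y)) (s x)))"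

definition Dis :: "'a quandle_pair \<Rightarrow> ('a \<Rightarrow> 'a) set" where
  "Dis Q = (case Q of (X, s) \<Rightarrow>
     generate (BijGroup X)
       {s x \<otimes>\<^bsub>BijGroup X\<^esub> inv\<^bsub>BijGroup X\<^esub> (s y) | x y. x \<in> X \<and> y \<in> X})"

definition Fix :: "('a \<Rightarrow> 'a) \<Rightarrow> 'a set \<Rightarrow> 'a set" where
  "Fix g X = {x \<in> X. g x = x}"

(* card is 0 on infinite sets, hence the extended count: an infinite fixed point set
   must not contribute 0 to the infimum below. *)
definition ecard :: "'a set \<Rightarrow> enat" where
  "ecard A = (if finite A then enat (card A) else \<infinity>)"

definition chi_Qdle :: "'a quandle_pair \<Rightarrow> enat" where
  "chi_Qdle Q = (INF g\<in>Dis Q. ecard (Fix g (fst Q)))"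

definition GAlex :: "('a, 'b) monoid_scheme \<Rightarrow> ('a \<Rightarrow> 'a) \<Rightarrow> 'a quandle_pair" where
  "GAlex G \<sigma> =
     (carrier G,
      \<lambda>h\<in>carrier G. \<lambda>g\<in>carrier G. h \<otimes>\<^bsub>G\<^esub> \<sigma> (inv\<^bsub>G\<^esub> h \<otimes>\<^bsub>G\<^esub> g))"

lemma Dis_subgroup:
  assumes "is_quandle (X, s)"
  shows "subgroup (Dis (X, s)) (BijGroup X)"
proof -
  interpret B: group "BijGroup X" by (rule group_BijGroup)
  have "s x \<in> carrier (BijGroup X)" if "x \<in> X" for x
    using assms that by (auto simp: is_quandle_def BijGroup_def Bij_def PiE_def)
  then show ?thesis
    unfolding Dis_def prod.case by (intro B.generate_is_subgroup) auto
qed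

lemma is_quandle_GAlex:
  assumes "group G" and \<sigma>: "\<sigma> \<in> iso G G"
  shows "is_quandle (GAlex G \<sigma>)"
proof -
  interpret G: group G by fact
  interpret \<sigma>: group_hom G G \<sigma>
    using \<sigma> by unfold_locales (simp add: iso_def)
  have bij: "bij_betw \<sigma> (carrier G) (carrier G)"
    using \<sigma> by (simp add: iso_def)
  have tr: "bij_betw (\<lambda>g. h \<otimes>\<^bsub>G\<^esub> g) (carrier G) (carrier G)" if "h \<in> carrier G" for h
    by (rule bij_betwI[where g = "\<lambda>g. inv\<^bsub>G\<^esub> h \<otimes>\<^bsub>G\<^esub> g"]) (use that in \<open>auto simp: G.m_assoc[symmetric]\<close>)
  have b: "bij_betw (\<lambda>g\<in>carrier G. h \<otimes>\<^bsub>G\<^esub> \<sigma> (inv\<^bsub>G\<^esub> h \<otimes>\<^bsub>G\<^esub> g)) (carrier G) (carrier G)"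
    if "h \<in> carrier G" for h
  proof -
    have "bij_betw ((\<lambda>g. h \<otimes>\<^bsub>G\<^esub> g) \<circ> (\<sigma> \<circ> (\<lambda>g. inv\<^bsub>G\<^esub> h \<otimes>\<^bsub>G\<^esub> g))) (carrier G) (carrier G)"
      using that by (intro bij_betw_trans[OF bij_betw_trans[OF tr bij] tr]) auto
    then show ?thesis
      by (simp add: o_def cong: bij_betw_cong)
  qed
  have c: "x \<otimes>\<^bsub>G\<^esub> \<sigma> (inv\<^bsub>G\<^esub> x \<otimes>\<^bsub>G\<^esub> (y \<otimes>\<^bsub>G\<^esub> \<sigma> (inv\<^bsub>G\<^esub> y \<otimes>\<^bsub>G\<^esub> z))) =
      (x \<otimes>\<^bsub>G\<^esub> \<sigma> (inv\<^bsub>G\<^esub> x \<otimes>\<^bsub>G\<^esub> y)) \<otimes>\<^bsub>G\<^esub>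
        \<sigma> (inv\<^bsub>G\<^esub> (x \<otimes>\<^bsub>G\<^esub> \<sigma> (inv\<^bsub>G\<^esub> x \<otimes>\<^bsub>G\<^esub> y)) \<otimes>\<^bsub>G\<^esub> (x \<otimes>\<^bsub>G\<^esub> \<sigma> (inv\<^bsub>G\<^esub> x \<otimes>\<^bsub>G\<^esub> z)))"
    if [simp]: "x \<in> carrier G" "y \<in> carrier G" "z \<in> carrier G" for x y z
  proof -
    have i: "inv\<^bsub>G\<^esub> a \<otimes>\<^bsub>G\<^esub> (a \<otimes>\<^bsub>G\<^esub> b) = b" "a \<otimes>\<^bsub>G\<^esub> (inv\<^bsub>G\<^esub> a \<otimes>\<^bsub>G\<^esub> b) = b"
      if "a \<in> carrier G" "b \<in> carrier G" for a b
      using that by (simp_all add: G.m_assoc[symmetric])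
    show ?thesis
      by (simp add: G.inv_mult_group G.m_assoc i)
  qed
  have ne: "carrier G \<noteq> {}"
    using G.one_closed by blast
  have id: "x \<otimes>\<^bsub>G\<^esub> \<sigma> (inv\<^bsub>G\<^esub> x \<otimes>\<^bsub>G\<^esub> x) = x" if "x \<in> carrier G" for x
    using that by simp
  have cl: "x \<otimes>\<^bsub>G\<^esub> \<sigma> (inv\<^bsub>G\<^esub> x \<otimes>\<^bsub>G\<^esub> y) \<in> carrier G"
    if "x \<in> carrier G" "y \<in> carrier G" for x y
    using that by simp
  show ?thesis
    unfolding is_quandle_def GAlex_def prod.case compose_def
  proof (intro conjI ballI Pi_I restrict_ext ne, goal_cases)
    case (1 x)
    then show ?case by (simp add: restrict_PiE_iff)
  next
    case (2 x)
    then show ?case by (simp add: id)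
  next
    case (3 x)
    then show ?case using b by simp
  next
    case (4 x y z)
    then show ?case using c[OF 4] by (simp only: restrict_apply' cl)
  qed
qed

end

theory Submission
  imports Defs
begin

text \<open>
  In the generalized Alexander quandle the symmetry at \<open>h\<close> is \<open>g \<mapsto> (h \<sigma>(h)\<^sup>-\<^sup>1) \<sigma>(g)\<close>: all
  symmetries are left translates of the same bijection \<open>\<sigma>\<close>. Hence \<open>s\<^sub>h \<circ> s\<^sub>1\<^sup>-\<^sup>1\<close> is left
  multiplication by \<open>h \<sigma>(h)\<^sup>-\<^sup>1\<close>. For a point \<open>h\<close> moved by \<open>\<sigma>\<close> this element is not the identity, so
  the translation has no fixed point, and an element of the displacement group without fixed points
  makes the infimum zero.

  The inverse of \<open>s\<^sub>1\<close> need not be computed: a fixed point of \<open>a \<circ> b\<^sup>-\<^sup>1\<close> is the image under \<open>b\<close> of a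
  point where \<open>a\<close> and \<open>b\<close> agree (lemma \<open>Fix_mult_inv_BijGroup\<close>). So it suffices to exhibit two
  symmetries that agree nowhere (lemma \<open>chi_Qdle_eq_0_if_disagreeing_symmetries\<close>), and
  \<open>GAlex_symmetries_disagree\<close> does this for \<open>s\<^sub>h\<close> and \<open>s\<^sub>1\<close>.
\<close>

text \<open>Substituting \<open>x = b y\<close> turns \<open>a (b\<^sup>-\<^sup>1 x) = x\<close> into \<open>a y = b y\<close>.\<close>

lemma Fix_mult_inv_BijGroup:
  assumes a: "a \<in> Bij X" and b: "b \<in> Bij X"
  shows "Fix (a \<otimes>\<^bsub>BijGroup X\<^esub> inv\<^bsub>BijGroup X\<^esub> b) X = b ` {y \<in> X. a y = b y}"
proof -
  let ?f = "a \<otimes>\<^bsub>BijGroup X\<^esub> inv\<^bsub>BijGroup X\<^esub> b"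
  interpret B: group "BijGroup X" by (rule group_BijGroup)
  have carr: "a \<in> carrier (BijGroup X)" "b \<in> carrier (BijGroup X)"
    using a b by (simp_all add: BijGroup_def)
  then have "?f \<in> Bij X"
    using B.m_closed[OF carr(1) B.inv_closed[OF carr(2)]]
    by (simp only: BijGroup_def partial_object.simps)
  have mult: "g \<otimes>\<^bsub>BijGroup X\<^esub> b = compose X g b" if "g \<in> Bij X" for g
    using that b by (simp add: BijGroup_def)
  have "?f \<otimes>\<^bsub>BijGroup X\<^esub> b = a"
    using carr by (simp add: B.m_assoc)
  then have comp: "compose X ?f b = a"
    by (simp only: mult[OF \<open>?f \<in> Bij X\<close>])
  have f: "?f (b y) = a y" if "y \<in> X" for y
    using compose_eq[OF that, of ?f b] unfolding comp by (rule sym)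
  have "b ` X = X"
    using b by (simp add: Bij_def bij_betw_def)
  then have "Fix ?f X = {x \<in> b ` X. ?f x = x}"
    by (simp only: Fix_def)
  also have "\<dots> = b ` {y \<in> X. ?f (b y) = b y}"
    by blast
  also have "\<dots> = b ` {y \<in> X. a y = b y}"
    using f by (simp cong: conj_cong)
  finally show ?thesis .
qed

text \<open>The displacement \<open>s\<^sub>x \<circ> s\<^sub>z\<^sup>-\<^sup>1\<close> attains the infimum: it has no fixed point.\<close>

lemma chi_Qdle_eq_0_if_disagreeing_symmetries:
  assumes Q: "is_quandle (X, s)" and x: "x \<in> X" and z: "z \<in> X"
    and disagree: "\<And>y. y \<in> X \<Longrightarrow> s x y \<noteq> s z y"
  shows "chi_Qdle (X, s) = 0"
proof -
  let ?f = "s x \<otimes>\<^bsub>BijGroup X\<^esub> inv\<^bsub>BijGroup X\<^esub> (s z)"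
  have "s x \<in> Bij X" "s z \<in> Bij X"
    using Q x z by (auto simp: is_quandle_def Bij_def PiE_def)
  then have "Fix ?f X = {}"
    using disagree by (auto simp: Fix_mult_inv_BijGroup)
  then have "ecard (Fix ?f X) = 0"
    by (simp add: ecard_def zero_enat_def)
  moreover have "?f \<in> Dis (X, s)"
    unfolding Dis_def prod.case using x z by (intro generate.incl) blast
  ultimately have "chi_Qdle (X, s) \<le> 0"
    unfolding chi_Qdle_def fst_conv by (intro INF_lower2) auto
  then show ?thesis by simp
qed

text \<open>If \<open>h \<sigma>(h)\<^sup>-\<^sup>1 \<sigma>(y) = \<sigma>(y)\<close> for a single \<open>y\<close>, cancelling \<open>\<sigma>(y)\<close> already forces \<open>\<sigma>(h) = h\<close>.\<close>

lemma GAlex_symmetries_disagree: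
  assumes "group G" and \<sigma>: "\<sigma> \<in> iso G G"
    and h: "h \<in> carrier G" "\<sigma> h \<noteq> h" and y: "y \<in> carrier G"
  shows "snd (GAlex G \<sigma>) h y \<noteq> snd (GAlex G \<sigma>) \<one>\<^bsub>G\<^esub> y"
proof
  interpret G: group G by fact
  interpret \<sigma>: group_hom G G \<sigma>
    using \<sigma> by unfold_locales (simp add: iso_def)
  assume "snd (GAlex G \<sigma>) h y = snd (GAlex G \<sigma>) \<one>\<^bsub>G\<^esub> y"
  then have "(h \<otimes>\<^bsub>G\<^esub> inv\<^bsub>G\<^esub> (\<sigma> h)) \<otimes>\<^bsub>G\<^esub> \<sigma> y = \<sigma> y"
    using h y by (simp add: GAlex_def G.m_assoc)
  then have "h \<otimes>\<^bsub>G\<^esub> inv\<^bsub>G\<^esub> (\<sigma> h) = \<one>\<^bsub>G\<^esub>"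
    using h y by simp
  then have "inv\<^bsub>G\<^esub> (inv\<^bsub>G\<^esub> (\<sigma> h)) = h"
    by (rule G.inv_equality) (use h in auto)
  moreover have "inv\<^bsub>G\<^esub> (inv\<^bsub>G\<^esub> (\<sigma> h)) = \<sigma> h"
    by (rule G.inv_inv) (rule \<sigma>.hom_closed[OF h(1)])
  ultimately show False
    using h(2) by metis
qed

theorem theorem1p4:
  fixes G :: "('a, 'b) monoid_scheme" and \<sigma> :: "'a \<Rightarrow> 'a"
  assumes "group G"
    and "\<sigma> \<in> iso G G"
    and "\<exists>g\<in>carrier G. \<sigma> g \<noteq> g"
  shows "chi_Qdle (GAlex G \<sigma>) = 0"
proof -
  interpret G: group G by fact
  obtain h where h: "h \<in> carrier G" "\<sigma> h \<noteq> h"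
    using assms(3) by blast
  have pair: "GAlex G \<sigma> = (carrier G, snd (GAlex G \<sigma>))"
    by (simp add: GAlex_def)
  have "is_quandle (carrier G, snd (GAlex G \<sigma>))"
    using is_quandle_GAlex[OF assms(1,2)] by (simp only: pair[symmetric])
  then have "chi_Qdle (carrier G, snd (GAlex G \<sigma>)) = 0"
    using GAlex_symmetries_disagree[OF assms(1,2) h]
    by (rule chi_Qdle_eq_0_if_disagreeing_symmetries[OF _ h(1) G.one_closed])
  then show ?thesis
    by (simp only: pair[symmetric])
qed

end
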